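(* Let $\Omega\subseteq\mathbb{R}^d$ be measurable, let $p(\cdot)\in\mathcal{P}$ with $p_+<\infty$, and suppose that there exists a measurable set $A_{t_0}\subseteq\Omega$ with $\mu(A_{t_0})=t_0>0$ such that $p(x)=p_-$ for all $x\in A_{t_0}$. Then $$\mathcal{E}_{\mathsf G}^{L_{p(\cdot)}}(t)=\sup\left\{\|\chi_{A}\|_{p(\cdot)}^{-1}: A\subseteq\Omega\text{ measurable},\ \mu(A)=t\right\},\qquad 0<t<\min\{1,t_0\}.$$
   Context: $\mu$ is Lebesgue measure on $\Omega$; $\chi_A$ is the characteristic function of $A$. For a measurable $p(\cdot):\Omega\to(0,\infty)$ put $p_-=\operatorname{ess\,inf}_{x\in\Omega}p(x)$, $p_+=\operatorname{ess\,sup}_{x\in\Omega}p(x)$. $\mathcal{P}$ is the set of such functions with $p_->0$ (exponent functions). Variable Lebesgue space $L_{p(\cdot)}=L_{p(\cdot)}(\Omega)$: with $\varrho_{p(\cdot)}(f)=\int_\Omega|f(x)|^{p(x)}\,dx$, it consists of the measurable $f$ with $\varrho_{p(\cdot)}(f/\lambda)<\infty$ for some $\lambda>0$, with quasi-norm $\|f\|_{p(\cdot)}=\inf\{\lambda>0:\varrho_{p(\cdot)}(f/\lambda)\le1\}$. Rearrangement: $f^*(t)=\inf\{s>0:\mu(\{|f|>s\})\le t\}$, $t\ge0$ (with $\inf\emptyset=\infty$). Growth envelope function of a quasi-normed function space $X$ on $\Omega$: $\mathcal{E}_{\mathsf G}^X(t)=\sup\{f^*(t):\|f\|_X\le1\}$,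 $t>0$ (computed here with exactly the quasi-norm above). *)

theory Defs
  imports "HOL-Analysis.Analysis" "HOL-Probability.Essential_Supremum"
begin

text \<open>
  Everything is stated for an arbitrary measure space \<open>M\<close>; the case of a measurable subset
  \<open>\<Omega>\<close> of \<open>\<real>\<^sup>d\<close> is \<open>M = lebesgue_on \<Omega>\<close>. Functions on \<open>\<Omega>\<close> are total functions whose values outside
  \<open>\<Omega>\<close> play no role, and they are not identified when they agree almost everywhere.
\<close>

text \<open>The library provides \<^const>\<open>esssup\<close> but not its dual.\<close>

definition essinf :: "'a measure \<Rightarrow> ('a \<Rightarrow> ereal) \<Rightarrow> ereal" where
  "essinf M f = Sup {c. AE x in M. c \<le> f x}"

definition p_minus :: "'a measure \<Rightarrow> ('a \<Rightarrow> real) \<Rightarrow> ereal" where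
  "p_minus M p = essinf M (\<lambda>x. ereal (p x))"

definition p_plus :: "'a measure \<Rightarrow> ('a \<Rightarrow> real) \<Rightarrow> ereal" where
  "p_plus M p = esssup M (\<lambda>x. ereal (p x))"

definition exponent_functions :: "'a measure \<Rightarrow> ('a \<Rightarrow> real) set" where
  "exponent_functions M =
     {p \<in> borel_measurable M. (\<forall>x\<in>space M. 0 < p x) \<and> 0 < p_minus M p}"

definition modular :: "'a measure \<Rightarrow> ('a \<Rightarrow> real) \<Rightarrow> ('a \<Rightarrow> real) \<Rightarrow> ennreal" where
  "modular M p f = (\<integral>\<^sup>+x. ennreal (\<bar>f x\<bar> powr p x) \<partial>M)"

definition var_Lebesgue :: "'a measure \<Rightarrow> ('a \<Rightarrow> real) \<Rightarrow> ('a \<Rightarrow> real) set" where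
  "var_Lebesgue M p =
     {f \<in> borel_measurable M. \<exists>l>0. modular M p (\<lambda>x. f x / l) < \<infinity>}"

text \<open>
  The quasi-norm takes values in \<^typ>\<open>ennreal\<close>, where the infimum of the empty set is \<open>\<infinity>\<close>
  (over \<^typ>\<open>real\<close> it would be an unspecified value).
\<close>

definition var_norm :: "'a measure \<Rightarrow> ('a \<Rightarrow> real) \<Rightarrow> ('a \<Rightarrow> real) \<Rightarrow> ennreal" where
  "var_norm M p f = Inf {ennreal l | l. 0 < l \<and> modular M p (\<lambda>x. f x / l) \<le> 1}"

definition rearrangement :: "'a measure \<Rightarrow> ('a \<Rightarrow> real) \<Rightarrow> real \<Rightarrow> ennreal" where
  "rearrangement M f t =
     Inf {ennreal s | s. 0 < s \<and> emeasure M {x \<in> space M. \<bar>f x\<bar> > s} \<le> ennreal t}"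

text \<open>\<open>X\<close> is the underlying set of the function space and \<open>N\<close> its quasi-norm.\<close>

definition growth_envelope ::
  "'a measure \<Rightarrow> ('a \<Rightarrow> real) set \<Rightarrow> (('a \<Rightarrow> real) \<Rightarrow> ennreal) \<Rightarrow> real \<Rightarrow> ennreal" where
  "growth_envelope M X N t = Sup {rearrangement M f t | f. f \<in> X \<and> N f \<le> 1}"

end

theory Submission
  imports Defs
begin

text \<open>
  Write \<open>q = p\<^sub>-\<close>. For \<open>c \<ge> 1\<close> one has \<open>c powr q \<le> c powr p x\<close> almost everywhere. Applied to
  the level sets of \<open>f\<close>, this bounds \<open>f\<^sup>*(t)\<close> by \<open>t powr (- 1 / q)\<close> on the unit ball when
  \<open>t < 1\<close>; applied to indicators, it bounds \<open>\<parallel>\<chi>\<^sub>A\<parallel>\<close> from below by \<open>t powr (1 / q)\<close> when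
  \<open>\<mu>(A) = t\<close>. Since \<open>p = q\<close> on \<open>A\<^sub>0\<close>, both bounds are sharp, so both sides of the identity
  equal \<open>t powr (- 1 / q)\<close>. Equality is attained on the right by a subset of \<open>A\<^sub>0\<close>; on the
  left it is only approached, by normalised indicators of subsets of measure slightly larger
  than \<open>t\<close>, since \<open>f\<^sup>*(t) = 0\<close> whenever \<open>f\<close> is supported on a set of measure \<open>t\<close>.
\<close>

section \<open>The essential infimum as an almost everywhere lower bound\<close>

lemma essinf_AE: "AE x in M. essinf M f \<le> f x"
proof -
  let ?S = "{c. AE x in M. c \<le> f x}"
  have "-\<infinity> \<in> ?S" by simp
  then have "?S \<noteq> {}" by blast
  \<comment> \<open>There may be uncountably many essential lower bounds, each with its own null
    set. Reaching their supremum along a sequence leaves only a countable union of null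
    sets.\<close>
  then obtain u where u: "range u \<subseteq> ?S" "Sup ?S = (SUP n::nat. u n)"
    using Sup_countable_SUP[of ?S] by metis
  have "AE x in M. u n \<le> f x" for n
    using u(1) by auto
  then have "AE x in M. \<forall>n. u n \<le> f x"
    by (simp add: AE_all_countable)
  then show ?thesis
    unfolding essinf_def u(2) by eventually_elim (simp add: SUP_le_iff)
qed

section \<open>Modular and quasi-norm\<close>

lemma modular_mono:
  assumes p: "\<And>x. x \<in> space M \<Longrightarrow> 0 \<le> p x" and fg: "\<And>x. x \<in> space M \<Longrightarrow> \<bar>f x\<bar> \<le> \<bar>g x\<bar>"
  shows "modular M p f \<le> modular M p g"
  unfolding modular_def using p fg by (intro nn_integral_mono ennreal_leI powr_mono2) auto

text \<open>Chebyshev's inequality for a variable exponent. The hypothesis \<open>1 \<le> c\<close>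
  is what turns \<open>q \<le> p x\<close> into \<open>c powr q \<le> c powr p x\<close>.\<close>

lemma modular_ge_powr_emeasure:
  assumes AE: "AE x in M. q \<le> p x" and q: "0 \<le> q" and E: "E \<in> sets M"
    and c: "1 \<le> c" "\<And>x. x \<in> E \<Longrightarrow> c \<le> \<bar>f x\<bar>"
  shows "ennreal (c powr q) * emeasure M E \<le> modular M p f"
proof -
  have "ennreal (c powr q) * emeasure M E = (\<integral>\<^sup>+x. ennreal (c powr q) * indicator E x \<partial>M)"
    using E by (simp add: nn_integral_cmult_indicator)
  also have "\<dots> \<le> modular M p f"
    unfolding modular_def
  proof (rule nn_integral_mono_AE, use AE in eventually_elim)
    case (elim x)
    show ?case
    proof (cases "x \<in> E")
      case True
      have "c powr q \<le> c powr p x" using elim c(1) by (intro powr_mono)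
      also have "\<dots> \<le> \<bar>f x\<bar> powr p x"
        using elim q c True by (intro powr_mono2) auto
      finally show ?thesis using True by (simp add: ennreal_leI)
    qed simp
  qed
  finally show ?thesis .
qed

lemma modular_scaled_indicator:
  assumes A: "A \<in> sets M" and pq: "\<And>x. x \<in> A \<Longrightarrow> p x = q" and c: "0 \<le> c"
  shows "modular M p (\<lambda>x. c * indicat_real A x) = ennreal (c powr q) * emeasure M A"
proof -
  have "modular M p (\<lambda>x. c * indicat_real A x) = (\<integral>\<^sup>+x. ennreal (c powr q) * indicator A x \<partial>M)"
    unfolding modular_def using pq c by (intro nn_integral_cong) (auto simp: indicator_def)
  then show ?thesis using A by (simp add: nn_integral_cmult_indicator)
qed

text \<open>The infimum need not be known to be attained: strict inequality yields an admissible
  \<open>k < l\<close>, and the modular decreases when the divisor grows.\<close>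

lemma modular_le_1_of_var_norm_less:
  assumes p: "\<And>x. x \<in> space M \<Longrightarrow> 0 \<le> p x" and less: "var_norm M p f < ennreal l"
  shows "modular M p (\<lambda>x. f x / l) \<le> 1"
proof -
  obtain k where k: "0 < k" "ennreal k < ennreal l" "modular M p (\<lambda>x. f x / k) \<le> 1"
    using less unfolding var_norm_def Inf_less_iff by auto
  then have "k < l" by (simp add: ennreal_less_iff)
  then have "modular M p (\<lambda>x. f x / l) \<le> modular M p (\<lambda>x. f x / k)"
    using k(1) by (intro modular_mono p) (auto intro!: divide_left_mono)
  then show ?thesis using k(3) by simp
qed

lemma var_norm_le:
  assumes "0 < l" "modular M p (\<lambda>x. f x / l) \<le> 1"
  shows "var_norm M p f \<le> ennreal l"
  unfolding var_norm_def using assms by (intro Inf_lower) auto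

section \<open>Sharp bounds by powers of \<open>t\<close>\<close>

lemma rearrangement_le_powr:
  assumes p: "\<And>x. x \<in> space M \<Longrightarrow> 0 \<le> p x" and AE: "AE x in M. q \<le> p x" and q: "0 < q"
    and f[measurable]: "f \<in> borel_measurable M" and norm: "var_norm M p f \<le> 1"
    and t: "0 < t" "t \<le> 1"
  shows "rearrangement M f t \<le> ennreal (t powr (- 1 / q))"
proof (rule ennreal_le_epsilon)
  fix e :: real assume e: "0 < e"
  \<comment> \<open>Chebyshev is applied to \<open>f / l\<close> at height \<open>c\<close>, where
    \<open>c powr q = 1 / t\<close>; here \<open>t \<le> 1\<close> gives \<open>1 \<le> c\<close>.
    The margin \<open>e\<close> makes \<open>l > 1\<close>, so the norm lies strictly below
    \<open>l\<close> and the modular of \<open>f / l\<close> is at most 1.\<close>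
  define s where "s = t powr (- 1 / q) + e"
  define c where "c = t powr (- 1 / q)"
  define l where "l = s / c"
  have c: "1 \<le> c" using t q powr_mono2'[of "-1/q" t 1] unfolding c_def by simp
  have s: "c < s" "0 < s" using e c by (auto simp: s_def c_def)
  have l: "1 < l" "s / l = c" using c s by (auto simp: l_def)
  have cq: "c powr q = 1 / t"
    using t q by (simp add: c_def powr_powr powr_minus_divide powr_divide)
  let ?E = "{x \<in> space M. \<bar>f x\<bar> > s}"
  have "var_norm M p f < ennreal l"
    using norm l(1) by (metis ennreal_1 ennreal_less_iff less_eq_real_def order_le_less_trans zero_less_one)
  then have "modular M p (\<lambda>x. f x / l) \<le> 1"
    using p by (intro modular_le_1_of_var_norm_less)
  moreover have "ennreal (c powr q) * emeasure M ?E \<le> modular M p (\<lambda>x. f x / l)"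
  proof (rule modular_ge_powr_emeasure[OF AE _ _ c])
    fix x assume "x \<in> ?E"
    then have "s / l \<le> \<bar>f x\<bar> / l" using l by (intro divide_right_mono) auto
    then show "c \<le> \<bar>f x / l\<bar>" using l by simp
  qed (use q in simp_all)
  ultimately have "ennreal (1 / t) * emeasure M ?E \<le> 1" unfolding cq by order
  then have "ennreal t * (ennreal (1 / t) * emeasure M ?E) \<le> ennreal t * 1"
    by (rule mult_left_mono) simp
  then have "emeasure M ?E \<le> ennreal t"
    using t by (simp add: mult.assoc[symmetric] ennreal_mult[symmetric])
  then have "rearrangement M f t \<le> ennreal s"
    unfolding rearrangement_def using s by (intro Inf_lower) auto
  then show "rearrangement M f t \<le> ennreal (t powr (- 1 / q)) + ennreal e"
    using e by (simp add: s_def)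
qed

lemma var_norm_indicator_ge_powr:
  assumes AE: "AE x in M. q \<le> p x" and q: "0 < q" and A: "A \<in> sets M" "emeasure M A = ennreal t"
    and t: "0 < t" "t \<le> 1"
  shows "ennreal (t powr (1 / q)) \<le> var_norm M p (indicat_real A)"
  unfolding var_norm_def
proof (rule Inf_greatest, clarify)
  fix l :: real assume l: "0 < l" and le1: "modular M p (\<lambda>x. indicat_real A x / l) \<le> 1"
  have "t powr (1 / q) \<le> l"
  \<comment> \<open>Chebyshev at height \<open>1 / l\<close> requires \<open>1 / l \<ge> 1\<close>.
    For \<open>l > 1\<close> the bound is immediate, since
    \<open>t powr (1 / q) \<le> 1\<close>.\<close>
  proof (cases "l \<le> 1")
    case True
    have "ennreal ((1 / l) powr q) * emeasure M A \<le> modular M p (\<lambda>x. indicat_real A x / l)"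
      using True l q A by (intro modular_ge_powr_emeasure[OF AE]) auto
    then have "ennreal ((1 / l) powr q * t) \<le> ennreal 1"
      using le1 t by (simp add: A(2) ennreal_mult)
    then have "(1 / l) powr q * t \<le> 1" by (simp only: ennreal_le_iff zero_le_one)
    then have "t \<le> l powr q" using l by (simp add: powr_divide field_simps)
    then have "t powr (1 / q) \<le> (l powr q) powr (1 / q)" using t q by (intro powr_mono2) auto
    then show ?thesis using l q by (simp add: powr_powr)
  next
    case False
    have "t powr (1 / q) \<le> 1" using t q by (intro powr_le1) auto
    then show ?thesis using False by simp
  qed
  then show "ennreal (t powr (1 / q)) \<le> ennreal l" by (rule ennreal_leI)
qed

lemma var_norm_indicator_le_powr:
  assumes A: "A \<in> sets M" "emeasure M A = ennreal t" and pq: "\<And>x. x \<in> A \<Longrightarrow> p x = q"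
    and q: "q \<noteq> 0" and t: "0 < t"
  shows "var_norm M p (indicat_real A) \<le> ennreal (t powr (1 / q))"
proof (rule var_norm_le)
  have "modular M p (\<lambda>x. (1 / t powr (1 / q)) * indicat_real A x)
          = ennreal ((1 / t powr (1 / q)) powr q) * ennreal t"
    using modular_scaled_indicator[where p = p, OF A(1) pq, of "1 / t powr (1 / q)"] A(2) by simp
  also have "\<dots> = 1" using t q by (simp add: powr_divide powr_powr flip: ennreal_mult)
  finally show "modular M p (\<lambda>x. indicat_real A x / t powr (1 / q)) \<le> 1" by simp
qed (use t in simp)

text \<open>Below height \<open>c\<close> every level set is all of \<open>A\<close>, whose measure
  exceeds \<open>t\<close>, so no \<open>s < c\<close> enters the infimum.\<close>

lemma rearrangement_scaled_indicator_ge: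
  assumes A: "A \<in> sets M" "ennreal t < emeasure M A" and c: "0 < c"
  shows "ennreal c \<le> rearrangement M (\<lambda>x. c * indicat_real A x) t"
  unfolding rearrangement_def
proof (rule Inf_greatest, clarify, rule ccontr)
  fix s assume s: "0 < s" "\<not> ennreal c \<le> ennreal s"
    and le: "emeasure M {x \<in> space M. \<bar>c * indicat_real A x\<bar> > s} \<le> ennreal t"
  have "s < c" using s by (meson ennreal_leI not_less)
  then have "{x \<in> space M. \<bar>c * indicat_real A x\<bar> > s} = A"
    using s c sets.sets_into_space[OF A(1)] by (auto simp: indicator_def)
  then show False using le A(2) by simp
qed

section \<open>Inversion in \<open>ennreal\<close> and subsets of prescribed measure\<close>

lemma inverse_ennreal_antimono:
  fixes a b :: ennreal
  shows "a \<le> b \<Longrightarrow> inverse b \<le> inverse a"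
  by (cases a; cases b; cases "a = 0")
     (auto simp: top_unique inverse_ennreal less_le intro!: ennreal_leI le_imp_inverse_le)

text \<open>Intermediate value theorem for the measure of \<open>S\<close> cut by a ball of growing
  radius. Since \<open>t\<close> is strictly below the measure of \<open>S\<close>, some finite
  radius overshoots it, even if that measure is infinite.\<close>

lemma exists_subset_emeasure_eq:
  fixes S :: "'a::euclidean_space set"
  assumes S: "S \<in> sets lebesgue" and t: "0 \<le> t" "ennreal t < emeasure lebesgue S"
  obtains T where "T \<in> sets lebesgue" "T \<subseteq> S" "emeasure lebesgue T = ennreal t"
proof -
  define B where "B r = S \<inter> cball 0 r" for r
  define g where "g r = measure lebesgue (B r)" for r
  have B: "B r \<in> lmeasurable" for r
    unfolding B_def using S by (subst Int_commute, intro fmeasurable_Int_fmeasurable) auto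
  have emB: "emeasure lebesgue (B r) = ennreal (g r)" for r
    using B[of r] by (simp add: g_def emeasure_eq_measure2)
  have "(\<Union>n. B (real n)) = S"
    unfolding B_def by (auto simp: real_arch_simple)
  moreover have "incseq (\<lambda>n. B (real n))"
    unfolding B_def by (intro monoI) auto
  then have "(SUP n. emeasure lebesgue (B (real n))) = emeasure lebesgue (\<Union>n. B (real n))"
    using B by (intro SUP_emeasure_incseq) auto
  ultimately obtain n where "ennreal t < emeasure lebesgue (B (real n))"
    using t(2) by (metis (no_types, lifting) less_SUP_iff)
  then have n: "t < g (real n)" using t by (simp add: emB ennreal_less_iff)
  \<comment> \<open>What \<open>S\<close> gains between two radii lies in the shell between the
    balls, so \<open>g\<close> inherits continuity from the ball volume.\<close>
  have g_diff: "\<bar>g r - g s\<bar> \<le> \<bar>measure lebesgue (cball (0::'a) r) - measure lebesgue (cball (0::'a) s)\<bar>"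
    for r s
  proof -
    have *: "\<bar>g r - g s\<bar> \<le> \<bar>measure lebesgue (cball (0::'a) r) - measure lebesgue (cball (0::'a) s)\<bar>"
      if "r \<le> s" for r s
    proof -
      have sub: "B r \<subseteq> B s" "cball (0::'a) r \<subseteq> cball 0 s" using that by (auto simp: B_def)
      have "g s - g r = measure lebesgue (B s - B r)"
        unfolding g_def using B sub by (intro measurable_measure_Diff[symmetric]) auto
      also have "\<dots> \<le> measure lebesgue (cball (0::'a) s - cball 0 r)"
        using B by (intro measure_mono_fmeasurable fmeasurable_Diff) (auto simp: B_def)
      also have "\<dots> = measure lebesgue (cball (0::'a) s) - measure lebesgue (cball (0::'a) r)"
        using sub by (intro measurable_measure_Diff) auto
      finally show ?thesis
        using measure_mono_fmeasurable[OF sub(1)] B unfolding g_def by auto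
    qed
    show ?thesis using *[of r s] *[of s r] by (cases "r \<le> s") auto
  qed
  have "continuous_on {0..real n} g"
  proof (rule continuous_on_eq_continuous_within[THEN iffD2], rule ballI)
    fix s assume s: "s \<in> {0..real n}"
    \<comment> \<open>This formula is the ball volume for nonnegative radii, hence the restriction
      to \<open>{0..real n}\<close>.\<close>
    define h where "h r = unit_ball_vol (DIM('a)) * r ^ DIM('a)" for r
    have h: "measure lebesgue (cball (0::'a) r) = h r" if "0 \<le> r" for r
      using that content_cball[of r "0::'a"] by (simp add: h_def measure_completion)
    have "(h \<longlongrightarrow> h s) (at s within {0..real n})"
      unfolding h_def by (intro tendsto_intros)
    then have lim0: "((\<lambda>r. \<bar>h r - h s\<bar>) \<longlongrightarrow> 0) (at s within {0..real n})"
      by (simp add: LIM_zero_iff tendsto_rabs_zero_iff)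
    have "((\<lambda>r. g r - g s) \<longlongrightarrow> 0) (at s within {0..real n})"
    proof (rule tendsto_rabs_zero_cancel, rule tendsto_sandwich[OF _ _ tendsto_const lim0])
      show "\<forall>\<^sub>F r in at s within {0..real n}. \<bar>g r - g s\<bar> \<le> \<bar>h r - h s\<bar>"
        unfolding eventually_at_filter using g_diff[of _ s] s by (intro always_eventually) (auto simp flip: h)
    qed simp
    then show "continuous (at s within {0..real n}) g"
      by (simp add: continuous_within LIM_zero_iff)
  qed
  moreover have "g 0 \<le> t"
  proof -
    have "negligible (B 0)"
      by (rule negligible_subset[OF negligible_sing[of 0]]) (auto simp: B_def)
    then show ?thesis using t by (simp add: g_def negligible_imp_measure0)
  qed
  ultimately obtain r where "g r = t"
    using IVT'[of g 0 t "real n"] n by auto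
  then show thesis
    using that[of "B r"] B[of r] emB[of r] by (auto simp: B_def)
qed

section \<open>Growth envelope and indicator supremum over
  \<open>lebesgue_on \<Omega>\<close>\<close>

theorem corollary5p7:
  fixes \<Omega> :: "(real ^ 'd) set" and p :: "real ^ 'd \<Rightarrow> real"
    and A0 :: "(real ^ 'd) set" and t0 :: ennreal and t :: real
  assumes "\<Omega> \<in> sets lebesgue"
    and "p \<in> exponent_functions (lebesgue_on \<Omega>)"
    and "p_plus (lebesgue_on \<Omega>) p < \<infinity>"
    and "A0 \<in> sets lebesgue" and "A0 \<subseteq> \<Omega>"
    and "emeasure lebesgue A0 = t0" and "0 < t0"
    and "\<And>x. x \<in> A0 \<Longrightarrow> ereal (p x) = p_minus (lebesgue_on \<Omega>) p"
    and "0 < t" and "ennreal t < min 1 t0"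
  shows "growth_envelope (lebesgue_on \<Omega>)
           (var_Lebesgue (lebesgue_on \<Omega>) p) (var_norm (lebesgue_on \<Omega>) p) t =
         Sup {inverse (var_norm (lebesgue_on \<Omega>) p (indicat_real A)) | A.
                A \<in> sets lebesgue \<and> A \<subseteq> \<Omega> \<and> emeasure lebesgue A = ennreal t}"
proof -
  let ?M = "lebesgue_on \<Omega>"
  have t: "0 < t" "t < 1" "ennreal t < emeasure lebesgue A0"
    using assms(6,9,10) by (auto simp: ennreal_less_iff simp flip: ennreal_1)
  \<comment> \<open>A point of \<open>A0\<close> shows that the \<open>ereal\<close> value
    \<open>p_minus\<close> is a real number.\<close>
  have "A0 \<noteq> {}" using assms(6,7) by auto
  then obtain q where q: "p_minus ?M p = ereal q" using assms(8) by (metis all_not_in_conv)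
  have q0: "0 < q" using assms(2) q by (simp add: exponent_functions_def)
  have pq: "p x = q" if "x \<in> A0" for x using assms(8)[OF that] q by simp
  have p: "0 \<le> p x" if "x \<in> space ?M" for x
    using assms(2) that by (auto simp: exponent_functions_def intro: less_imp_le)
  have AE: "AE x in ?M. q \<le> p x"
    using essinf_AE[of ?M "\<lambda>x. ereal (p x)"] q by (simp add: p_minus_def)
  have sets_M: "A \<in> sets ?M" if "A \<in> sets lebesgue" "A \<subseteq> \<Omega>" for A
    using that assms(1) by (simp add: sets_restrict_space_iff)
  have emeasure_M: "emeasure ?M A = emeasure lebesgue A" if "A \<subseteq> \<Omega>" for A
    using that assms(1) by (simp add: emeasure_restrict_space)
  define v where "v = ennreal (t powr (- 1 / q))"
  have inverse_norm: "inverse (ennreal (t powr (1 / q))) = v"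
    using t(1) by (simp add: v_def inverse_ennreal powr_minus)

  have "growth_envelope ?M (var_Lebesgue ?M p) (var_norm ?M p) t = v"
  proof (rule antisym)
    show "growth_envelope ?M (var_Lebesgue ?M p) (var_norm ?M p) t \<le> v"
      unfolding growth_envelope_def v_def
      by (rule Sup_least, clarify, rule rearrangement_le_powr[OF p AE q0])
         (use t in \<open>auto simp: var_Lebesgue_def\<close>)
    have approx: "ennreal (u powr (- 1 / q)) \<le>
        growth_envelope ?M (var_Lebesgue ?M p) (var_norm ?M p) t"
      if u: "t < u" "ennreal u < emeasure lebesgue A0" for u
    proof -
      obtain T where T: "T \<in> sets lebesgue" "T \<subseteq> A0" "emeasure lebesgue T = ennreal u"
        using exists_subset_emeasure_eq[OF assms(4) _ u(2)] u t by auto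
      have TM: "T \<in> sets ?M" "emeasure ?M T = ennreal u"
        using T assms(5) sets_M emeasure_M by auto
      \<comment> \<open>The height satisfies \<open>?c powr q = 1 / u\<close>; as
        \<open>p = q\<close> on \<open>T\<close>, the modular of \<open>?f\<close> is exactly
        1.\<close>
      let ?c = "u powr (- 1 / q)" and ?f = "\<lambda>x. u powr (- 1 / q) * indicat_real T x"
      have "modular ?M p ?f = ennreal (?c powr q) * ennreal u"
        using modular_scaled_indicator[of T ?M p q ?c] TM T(2) pq by auto
      also have "\<dots> = 1"
        using u t q0 by (simp add: powr_powr powr_minus_divide powr_divide flip: ennreal_mult)
      finally have mod: "modular ?M p (\<lambda>x. ?f x / 1) = 1" by simp
      have "?f \<in> var_Lebesgue ?M p"
        unfolding var_Lebesgue_def using TM mod by (auto intro!: exI[of _ "1::real"])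
      moreover have "var_norm ?M p ?f \<le> 1"
        using var_norm_le[of 1 ?M p ?f] mod by simp
      ultimately have "rearrangement ?M ?f t \<le>
          growth_envelope ?M (var_Lebesgue ?M p) (var_norm ?M p) t"
        unfolding growth_envelope_def by (intro Sup_upper) blast
      moreover have "ennreal ?c \<le> rearrangement ?M ?f t"
        using TM u t by (intro rearrangement_scaled_indicator_ge) (auto simp: ennreal_less_iff)
      ultimately show ?thesis by order
    qed
    \<comment> \<open>\<open>A0\<close> may have infinite measure, so density supplies a real
      \<open>b\<close>; every \<open>u\<close> between \<open>t\<close> and \<open>b\<close> is then
      admissible in \<open>approx\<close>.\<close>
    obtain b where b: "t < b" "ennreal b < emeasure lebesgue A0"
    proof -
      obtain z where z: "ennreal t < z" "z < emeasure lebesgue A0" using dense t(3) by blast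
      then obtain b where "z = ennreal b" "0 \<le> b" by (cases z) auto
      then show thesis using that[of b] z t by (simp add: ennreal_less_iff)
    qed
    \<comment> \<open>Letting \<open>u\<close> decrease to \<open>t\<close> recovers the bound that
      no single \<open>?f\<close> provides.\<close>
    have "((\<lambda>u. ennreal (u powr (- 1 / q))) \<longlongrightarrow> v) (at_right t)"
      unfolding v_def using t by (intro tendsto_ennrealI tendsto_intros) auto
    moreover have "\<forall>\<^sub>F u in at_right t. ennreal (u powr (- 1 / q)) \<le>
        growth_envelope ?M (var_Lebesgue ?M p) (var_norm ?M p) t"
      unfolding eventually_at_right_field
    proof (intro exI[of _ b] conjI allI impI b(1))
      fix u assume u: "t < u" "u < b"
      then have "ennreal u < emeasure lebesgue A0"
        using b(2) by (meson ennreal_leI less_imp_le order_le_less_trans)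
      then show "ennreal (u powr (- 1 / q)) \<le>
          growth_envelope ?M (var_Lebesgue ?M p) (var_norm ?M p) t"
        using approx u(1) by blast
    qed
    ultimately show "v \<le> growth_envelope ?M (var_Lebesgue ?M p) (var_norm ?M p) t"
      by (intro tendsto_upperbound[of _ v "at_right t"]) auto
  qed
  moreover have "Sup {inverse (var_norm ?M p (indicat_real A)) | A.
      A \<in> sets lebesgue \<and> A \<subseteq> \<Omega> \<and> emeasure lebesgue A = ennreal t} = v"
  proof (rule antisym)
    show "Sup {inverse (var_norm ?M p (indicat_real A)) | A.
      A \<in> sets lebesgue \<and> A \<subseteq> \<Omega> \<and> emeasure lebesgue A = ennreal t} \<le> v"
    proof (rule Sup_least, clarify)
      fix A assume A: "A \<in> sets lebesgue" "A \<subseteq> \<Omega>" "emeasure lebesgue A = ennreal t"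
      have "ennreal (t powr (1 / q)) \<le> var_norm ?M p (indicat_real A)"
        using A sets_M emeasure_M t by (intro var_norm_indicator_ge_powr[OF AE q0]) auto
      then show "inverse (var_norm ?M p (indicat_real A)) \<le> v"
        unfolding inverse_norm[symmetric] by (rule inverse_ennreal_antimono)
    qed
    obtain T where T: "T \<in> sets lebesgue" "T \<subseteq> A0" "emeasure lebesgue T = ennreal t"
      using exists_subset_emeasure_eq[OF assms(4) _ t(3)] t by auto
    have "var_norm ?M p (indicat_real T) \<le> ennreal (t powr (1 / q))"
      using T sets_M emeasure_M t q0 pq assms(5) by (intro var_norm_indicator_le_powr) auto
    then have "v \<le> inverse (var_norm ?M p (indicat_real T))"
      unfolding inverse_norm[symmetric] by (rule inverse_ennreal_antimono)
    also have "\<dots> \<le> Sup {inverse (var_norm ?M p (indicat_real A)) | A.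
        A \<in> sets lebesgue \<and> A \<subseteq> \<Omega> \<and> emeasure lebesgue A = ennreal t}"
      using T assms(5) by (intro Sup_upper) blast
    finally show "v \<le> \<dots>" .
  qed
  ultimately show ?thesis by simp
qed

end
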